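(* Let $n$ be a positive integer, let $C \subseteq \mathbb{R}^n$ be a convex set, and let $p \in \mathbb{R}^n$ be a point with $p \notin \operatorname{int}(C)$. Then there exists a hyperplane that passes through $p$ and contains $C$ in one of its half-spaces; that is, there exists $N_p \in \mathbb{R}^n \setminus \{0\}$ such that $\langle N_p, v - p\rangle \leq 0$ for all $v \in C$.
   Context: $\operatorname{int}(C)$ denotes the topological interior of $C$ in $\mathbb{R}^n$, and $\langle\cdot,\cdot\rangle$ is the standard inner product on $\mathbb{R}^n$. The half-spaces of a hyperplane are closed: a half-space passing through $p$ is defined by a nonzero normal vector $N_p$ as $\{v \in \mathbb{R}^n : \langle N_p, v-p\rangle \le 0\}$. *)

theory Defs
  imports "HOL-Analysis.Analysis"
begin

end

theory Submission
  imports Defs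
begin

text \<open>If \<open>interior C\<close> is nonempty, it is a convex set missing \<open>p\<close>,
  so \<open>separating_hyperplane_sets\<close> separates the two, and the bound extends to
  \<open>C\<close> by density (\<open>convex_closure_interior\<close>). If it is empty,
  \<open>C\<close> is flat (\<open>empty_interior_subset_hyperplane\<close>), and a parallel
  hyperplane through \<open>p\<close> works.\<close>

theorem mainTheorem1:
  fixes C :: "(real ^ 'n) set" and p :: "real ^ 'n"
  assumes "convex C"
    and "p \<notin> interior C"
  shows "\<exists>N :: real ^ 'n. N \<noteq> 0 \<and> (\<forall>v\<in>C. N \<bullet> (v - p) \<le> 0)"
proof (cases "interior C = {}")
  case True
  then obtain a b where a: "a \<noteq> 0" and C: "C \<subseteq> {x. a \<bullet> x = b}"
    using empty_interior_subset_hyperplane[OF \<open>convex C\<close>] by metis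
  show ?thesis
  \<comment> \<open>On \<open>C\<close> the value of \<open>a \<bullet> (v - p)\<close> is the
    constant \<open>b - a \<bullet> p\<close>; its sign decides between \<open>a\<close> and
    \<open>- a\<close>.\<close>
  proof (cases "b \<le> a \<bullet> p")
    case True
    with a C show ?thesis
      by (intro exI[of _ a]) (auto simp: inner_diff_right)
  next
    case False
    with a C show ?thesis
      by (intro exI[of _ "- a"]) (auto simp: inner_diff_right)
  qed
next
  case False
  obtain a b where a: "a \<noteq> 0" and le: "\<forall>x\<in>interior C. a \<bullet> x \<le> b" and ge: "b \<le> a \<bullet> p"
    using separating_hyperplane_sets[of "interior C" "{p}"] False assms
    by (auto simp: convex_interior)
  \<comment> \<open>Separation bounds only the interior; boundary points of \<open>C\<close> are
    limits of interior ones, and the half-space is closed.\<close>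
  have "C \<subseteq> closure (interior C)"
    using convex_closure_interior[OF \<open>convex C\<close> False] closure_subset by metis
  also have "\<dots> \<subseteq> {x. a \<bullet> x \<le> b}"
    using le by (intro closure_minimal) (auto simp: closed_halfspace_le)
  finally have "C \<subseteq> {x. a \<bullet> x \<le> b}" .
  with a ge show ?thesis
    by (intro exI[of _ a]) (force simp: inner_diff_right)
qed

end
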